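(* Fix an integer $w\ge 0$. Consider lattice walks in $\mathbb{Z}^2$ with steps $(1,1)$, $(1,-1)$, $(2,2)$, $(2,-2)$ that start at $(0,0)$, end on the $x$-axis, and never leave the strip $0\le y\le w$ (the empty walk is included). Give each such walk the weight $z^{L/2}$, where $L$ is the total horizontal distance it travels (equivalently, weight $\sqrt z$ per unit distance along the $x$-axis), and let $F_w(z)$ be the sum of these weights, i.e. $F_w(z)=\sum_{n\ge 0} a_{w,n} z^n$ where $a_{w,n}$ is the number of such walks from $(0,0)$ to $(2n,0)$. Then for every $w\ge 4$, $$F_w = 1 - zF_w + 2zF_wF_{w-1} + 2z^2F_wF_{w-1}F_{w-2} - (z^3+z^4)F_wF_{w-1}F_{w-2}F_{w-3} + z^5F_wF_{w-1}F_{w-2}F_{w-3}F_{w-4}.$$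
   Context: $F_w(z)$ is regarded as a formal power series in $z$ (it is in fact a rational function). Combinatorially, $a_{w,n}$ counts basketball games (with scoring of 1 or 2 points) ending in an $n$:$n$ tie in which the home team never trails and never leads by more than $w$ points. *)

theory Defs
  imports
    "HOL-Library.Product_Plus"
    "HOL-Computational_Algebra.Formal_Power_Series"
begin

definition walk_steps :: "(int \<times> int) set" where
  "walk_steps = {(1, 1), (1, -1), (2, 2), (2, -2)}"

(* A walk is the list of its steps. The point reached after k steps is the sum of the
   first k steps, since the walk starts at the origin. The strip is convex, so a walk stays in it
   as soon as its vertices do. *)

definition strip_walks :: "nat \<Rightarrow> (int \<times> int) list set" where
  "strip_walks w =
     {p. set p \<subseteq> walk_steps \<and>
         (\<forall>k \<le> length p. 0 \<le> snd (sum_list (take k p)) \<and> snd (sum_list (take k p)) \<le> int w)}"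

definition num_walks :: "nat \<Rightarrow> nat \<Rightarrow> nat" where
  "num_walks w n = card {p \<in> strip_walks w. sum_list p = (2 * int n, 0)}"

(* Each step changes the horizontal and the vertical coordinate by the same amount modulo 2, so a
   walk that ends on the x-axis has even total length 2 n: no walk is missed below. *)

definition walk_gf :: "nat \<Rightarrow> int fps" where
  "walk_gf w = Abs_fps (\<lambda>n. int (num_walks w n))"

lemma even_fst_if_ends_on_axis:
  assumes "p \<in> strip_walks w" "snd (sum_list p) = 0"
  shows "even (fst (sum_list p))"
proof -
  have "even (fst (sum_list p) + snd (sum_list p))" if "set p \<subseteq> walk_steps" for p
    using that by (induction p) (auto simp: walk_steps_def)
  then show ?thesis
    using assms by (fastforce simp: strip_walks_def)
qed

lemma finite_strip_walks_to:
  "finite {p \<in> strip_walks w. sum_list p = (2 * int n, 0)}"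
proof (rule finite_subset)
  have len: "int (length p) \<le> fst (sum_list p)" if "set p \<subseteq> walk_steps" for p
    using that by (induction p) (auto simp: walk_steps_def)
  show "{p \<in> strip_walks w. sum_list p = (2 * int n, 0)}
          \<subseteq> {p. set p \<subseteq> walk_steps \<and> length p \<le> 2 * n}"
    using len by (fastforce simp: strip_walks_def)
  show "finite {p. set p \<subseteq> walk_steps \<and> length p \<le> 2 * n}"
    by (rule finite_lists_length_le) (simp add: walk_steps_def)
qed

end

theory Submission
  imports Defs "HOL-Computational_Algebra.Formal_Laurent_Series"
begin

text \<open>Count walks by their length in \<open>t\<close>, where \<open>z = t\<^sup>2\<close>, and let \<open>f\<close>, \<open>p\<close>, \<open>q\<close> be the series of
  the walks in the strip of width \<open>w\<close> from height 0 to 0, from 1 to 0, and from 1 to 1.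
  A first-step analysis is a linear system with a unique power series solution. Deleting the bottom
  level of the strip of width \<open>w + 1\<close> leaves the system of width \<open>w\<close> with other sources, and so
  expresses the series \<open>f'\<close>, \<open>p'\<close>, \<open>q'\<close> of width \<open>w + 1\<close> through \<open>f\<close>, \<open>p\<close>, \<open>q\<close>. These relations
  imply the Jacobi identity \<open>q' f' - p'\<^sup>2 = f' f\<close>, by which \<open>q\<close> becomes a polynomial in the \<open>f\<close>'s;
  \<open>p\<close> is then eliminated between two consecutive widths.\<close>

section \<open>Counting by the first step\<close>

text \<open>Heights and lengths are integers, so the first-step recursion may leave the strip or
  reach a negative length: the set is then empty, and no truncated subtraction arises.\<close>

definition walks_between :: "nat \<Rightarrow> int \<Rightarrow> int \<Rightarrow> int \<Rightarrow> (int \<times> int) list set" where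
  "walks_between w i j n =
     {p. set p \<subseteq> walk_steps \<and>
         (\<forall>k \<le> length p. 0 \<le> i + snd (sum_list (take k p)) \<and> i + snd (sum_list (take k p)) \<le> int w) \<and>
         sum_list p = (n, j - i)}"

lemma length_le_fst_sum_list: "set p \<subseteq> walk_steps \<Longrightarrow> int (length p) \<le> fst (sum_list p)"
  by (induction p) (auto simp: walk_steps_def)

lemma finite_walks_between: "finite (walks_between w i j n)"
proof (rule finite_subset)
  show "walks_between w i j n \<subseteq> {p. set p \<subseteq> walk_steps \<and> length p \<le> nat n}"
    using length_le_fst_sum_list by (fastforce simp: walks_between_def)
  show "finite {p. set p \<subseteq> walk_steps \<and> length p \<le> nat n}"
    by (rule finite_lists_length_le) (simp add: walk_steps_def)
qed

lemma walks_between_neg: "n < 0 \<Longrightarrow> walks_between w i j n = {}"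
  using length_le_fst_sum_list by (fastforce simp: walks_between_def)

lemma walks_between_outside: "\<not> (0 \<le> i \<and> i \<le> int w) \<Longrightarrow> walks_between w i j n = {}"
  by (force simp: walks_between_def dest: spec[of _ 0])

lemma Nil_in_walks_between:
  "[] \<in> walks_between w i j n \<longleftrightarrow> 0 \<le> i \<and> i \<le> int w \<and> i = j \<and> n = 0"
  by (auto simp: walks_between_def zero_prod_def)

lemma Cons_in_walks_between:
  "(a, b) # p \<in> walks_between w i j n \<longleftrightarrow>
     0 \<le> i \<and> i \<le> int w \<and> (a, b) \<in> walk_steps \<and> p \<in> walks_between w (i + b) j (n - a)"
proof -
  have all_Suc: "(\<forall>k \<le> Suc l. P k) \<longleftrightarrow> P 0 \<and> (\<forall>k \<le> l. P (Suc k))" for P and l :: nat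
    by (metis Suc_le_mono le0 not0_implies_Suc)
  have "(a, b) + s = (n, j - i) \<longleftrightarrow> s = (n - a, j - (i + b))" for s
    by (cases s) auto
  then show ?thesis
    unfolding walks_between_def mem_Collect_eq list.size(4) add_Suc_right add_0_right all_Suc
    by (auto simp: add.assoc)
qed

lemma card_walks_between:
  assumes "0 \<le> i" "i \<le> int w"
  shows "card (walks_between w i j n) = of_bool (i = j \<and> n = 0) +
     (\<Sum>s\<in>walk_steps. card (walks_between w (i + snd s) j (n - fst s)))"
proof -
  let ?C = "\<lambda>s. Cons s ` walks_between w (i + snd s) j (n - fst s)"
  let ?N = "if i = j \<and> n = 0 then {[]} else {} :: (int \<times> int) list set"
  have "p \<in> walks_between w i j n \<longleftrightarrow> p \<in> ?N \<union> (\<Union>s\<in>walk_steps. ?C s)" for p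
  proof (cases p)
    case Nil
    then show ?thesis
      using assms by (auto simp: Nil_in_walks_between)
  next
    case (Cons s p')
    then show ?thesis
      using assms by (cases s) (force simp: Cons_in_walks_between)
  qed
  then have "walks_between w i j n = ?N \<union> (\<Union>s\<in>walk_steps. ?C s)"
    by blast
  moreover have "finite walk_steps"
    by (simp add: walk_steps_def)
  moreover from this have "card (\<Union>s\<in>walk_steps. ?C s) = (\<Sum>s\<in>walk_steps. card (?C s))"
    by (intro card_UN_disjoint) (auto simp: finite_walks_between)
  moreover have "card (?C s) = card (walks_between w (i + snd s) j (n - fst s))" for s
    by (rule card_image) simp
  moreover have "?N \<inter> (\<Union>s\<in>walk_steps. ?C s) = {}"
    by auto
  ultimately show ?thesis
    by (simp only:) (subst card_Un_disjoint, auto simp: finite_walks_between)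
qed

text \<open>The end point comes before the starting point, so that \<open>walks_between_gf w j\<close> is the vector
  that solves the linear system with source at \<open>j\<close>.\<close>

definition walks_between_gf :: "nat \<Rightarrow> int \<Rightarrow> int \<Rightarrow> int fps" where
  "walks_between_gf w j i = Abs_fps (\<lambda>n. int (card (walks_between w i j (int n))))"

section \<open>The linear system of the strip\<close>

definition strip_system :: "int \<Rightarrow> (int \<Rightarrow> int fps) \<Rightarrow> (int \<Rightarrow> int fps) \<Rightarrow> bool" where
  "strip_system m b x \<longleftrightarrow> (\<forall>i. x i =
     (if 0 \<le> i \<and> i \<le> m
      then b i + fps_X * (x (i + 1) + x (i - 1)) + fps_X ^ 2 * (x (i + 2) + x (i - 2)) else 0))"

lemma strip_systemD:
  assumes "strip_system m b x"
  shows "0 \<le> i \<Longrightarrow> i \<le> m \<Longrightarrow>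
      x i = b i + fps_X * (x (i + 1) + x (i - 1)) + fps_X ^ 2 * (x (i + 2) + x (i - 2))"
    and "i < 0 \<Longrightarrow> x i = 0" and "m < i \<Longrightarrow> x i = 0"
  using assms unfolding strip_system_def by (meson not_le)+

lemma strip_system_walks_between_gf:
  "strip_system (int w) (\<lambda>i. of_bool (i = j)) (walks_between_gf w j)"
proof -
  let ?g = "walks_between_gf w j"
  have "?g i = of_bool (i = j) + fps_X * (?g (i + 1) + ?g (i - 1))
      + fps_X ^ 2 * (?g (i + 2) + ?g (i - 2))" if "0 \<le> i" "i \<le> int w" for i
  proof (rule fps_ext)
    fix n :: nat
    let ?N = "\<lambda>i n. int (card (walks_between w i j n))"
    have "?N i (int n) = of_bool (i = j \<and> n = 0) + (?N (i + 1) (int n - 1) + ?N (i - 1) (int n - 1))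
        + (?N (i + 2) (int n - 2) + ?N (i - 2) (int n - 2))"
      by (subst card_walks_between[OF that]) (simp add: walk_steps_def)
    \<comment> \<open>For \<open>n < k\<close> both sides vanish, the right one because no walk has
      negative length.\<close>
    moreover have "fps_nth (fps_X ^ k * (?g a + ?g b)) n = ?N a (int n - int k) + ?N b (int n - int k)"
      for a b k
      by (auto simp: fps_X_power_mult_nth walks_between_gf_def walks_between_neg of_nat_diff)
    from this[of 1] this[of 2] have
      "fps_nth (fps_X * (?g a + ?g b)) n = ?N a (int n - 1) + ?N b (int n - 1)"
      "fps_nth (fps_X ^ 2 * (?g a + ?g b)) n = ?N a (int n - 2) + ?N b (int n - 2)" for a b
      by simp_all
    moreover have "fps_nth (of_bool (i = j) :: int fps) n = of_bool (i = j \<and> n = 0)"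
      by simp
    ultimately show "fps_nth (?g i) n = fps_nth (of_bool (i = j) + fps_X * (?g (i + 1) + ?g (i - 1))
      + fps_X ^ 2 * (?g (i + 2) + ?g (i - 2))) n"
      by (simp only: fps_add_nth) (simp only: walks_between_gf_def fps_nth_Abs_fps)
  qed
  moreover have "?g i = 0" if "\<not> (0 \<le> i \<and> i \<le> int w)" for i
    by (simp add: walks_between_gf_def walks_between_outside[OF that] fps_ext)
  ultimately show ?thesis
    unfolding strip_system_def by auto
qed

text \<open>Neighbouring heights enter only with a factor \<open>fps_X\<close>, so the coefficients
  of order \<open>n\<close> are determined by \<open>b\<close> and lower orders; hence the induction
  on \<open>n\<close> for all heights at once.\<close>

lemma strip_system_unique:
  assumes "strip_system m b x" "strip_system m b y"
  shows "x i = y i"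
proof -
  have "fps_nth (x i) n = fps_nth (y i) n" for n
  proof (induction n arbitrary: i rule: less_induct)
    case (less n)
    show ?case
    proof (cases "0 \<le> i \<and> i \<le> m")
      case True
      have "fps_nth (fps_X ^ k * (x a + x c)) n = fps_nth (fps_X ^ k * (y a + y c)) n"
        if "k > 0" for k a c
        using less that by (simp add: fps_X_power_mult_nth)
      from this[of 1] this[of 2]
      have "fps_nth (fps_X * (x a + x c)) n = fps_nth (fps_X * (y a + y c)) n"
        "fps_nth (fps_X ^ 2 * (x a + x c)) n = fps_nth (fps_X ^ 2 * (y a + y c)) n" for a c
        by simp_all
      moreover have
        "x i = b i + fps_X * (x (i + 1) + x (i - 1)) + fps_X ^ 2 * (x (i + 2) + x (i - 2))"
        "y i = b i + fps_X * (y (i + 1) + y (i - 1)) + fps_X ^ 2 * (y (i + 2) + y (i - 2))"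
        using True by (intro strip_systemD(1)[OF assms(1)] strip_systemD(1)[OF assms(2)]; simp)+
      ultimately show ?thesis
        by (simp only: fps_add_nth)
    next
      case False
      then show ?thesis
        using assms[THEN strip_systemD(2), of i] assms[THEN strip_systemD(3), of i]
        by (metis not_le)
    qed
  qed
  then show ?thesis by (rule fps_ext)
qed

text \<open>Linearity and uniqueness. Sources at two levels suffice because no step descends by more
  than 2, so a deleted bottom level is felt only at the two levels above it.\<close>

lemma strip_system_superposition:
  assumes "strip_system (int w) b x"
    and b: "\<And>i. 0 \<le> i \<Longrightarrow> b i = u * of_bool (i = 0) + v * of_bool (i = 1)"
  shows "x i = u * walks_between_gf w 0 i + v * walks_between_gf w 1 i"
proof (rule strip_system_unique[OF assms(1)])
  note sys = strip_system_walks_between_gf[of w]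
  let ?g = "\<lambda>j. walks_between_gf w j"
  let ?y = "\<lambda>i. u * ?g 0 i + v * ?g 1 i"
  show "strip_system (int w) b ?y"
    unfolding strip_system_def
  proof (intro allI)
    fix i
    show "?y i = (if 0 \<le> i \<and> i \<le> int w
        then b i + fps_X * (?y (i + 1) + ?y (i - 1)) + fps_X ^ 2 * (?y (i + 2) + ?y (i - 2)) else 0)"
    proof (cases "0 \<le> i \<and> i \<le> int w")
      case True
      then have "?g 0 i = of_bool (i = 0) + fps_X * (?g 0 (i + 1) + ?g 0 (i - 1))
            + fps_X ^ 2 * (?g 0 (i + 2) + ?g 0 (i - 2))"
        "?g 1 i = of_bool (i = 1) + fps_X * (?g 1 (i + 1) + ?g 1 (i - 1))
            + fps_X ^ 2 * (?g 1 (i + 2) + ?g 1 (i - 2))"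
        using strip_systemD(1)[OF sys] by blast+
      then have "?y i = b i + fps_X * (?y (i + 1) + ?y (i - 1))
          + fps_X ^ 2 * (?y (i + 2) + ?y (i - 2))"
        unfolding b[OF conjunct1[OF True]] by (simp only: algebra_simps)
      then show ?thesis
        using True by simp
    next
      case False
      then have "?g 0 i = 0" "?g 1 i = 0"
        using strip_systemD(2,3)[OF sys] by (metis not_le)+
      then show ?thesis
        using False by auto
    qed
  qed
qed

text \<open>The terms with \<open>x 0\<close> move into the source: old level 1 steps down to it by
  1, old level 2 by 2. Without the cut at negative heights, \<open>x 0\<close> would reappear at
  height -1.\<close>

lemma strip_system_shift:
  assumes "strip_system (m + 1) b x"
  shows "strip_system m
    (\<lambda>i. b (i + 1) + fps_X * x 0 * of_bool (i = 0) + fps_X ^ 2 * x 0 * of_bool (i = 1))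
    (\<lambda>i. if i < 0 then 0 else x (i + 1))"
  unfolding strip_system_def
proof (intro allI)
  fix i :: int
  let ?y = "\<lambda>i. if i < 0 then 0 else x (i + 1)"
  let ?c = "b (i + 1) + fps_X * x 0 * of_bool (i = 0) + fps_X ^ 2 * x 0 * of_bool (i = 1)"
  show "?y i = (if 0 \<le> i \<and> i \<le> m
      then ?c + fps_X * (?y (i + 1) + ?y (i - 1)) + fps_X ^ 2 * (?y (i + 2) + ?y (i - 2)) else 0)"
  proof (cases "0 \<le> i \<and> i \<le> m")
    case True
    then have "x (i + 1) = b (i + 1) + fps_X * (x (i + 1 + 1) + x (i + 1 - 1))
        + fps_X ^ 2 * (x (i + 1 + 2) + x (i + 1 - 2))"
      by (intro strip_systemD(1)[OF assms]) auto
    moreover have "i + 1 + 1 = i + 2" "i + 1 - 1 = i" "i + 1 + 2 = i + 3" "i + 1 - 2 = i - 1"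
      by auto
    ultimately have x: "x (i + 1) = b (i + 1) + fps_X * (x (i + 2) + x i)
        + fps_X ^ 2 * (x (i + 3) + x (i - 1))"
      by (simp only:)
    have y: "?y i = x (i + 1)" "?y (i + 1) = x (i + 2)" "?y (i + 2) = x (i + 3)"
      using True by (simp_all add: add.assoc)
    have y1: "?y (i - 1) = (if i = 0 then 0 else x i)"
      using True by auto
    \<comment> \<open>For \<open>i = 1\<close> the dropped term is \<open>x 0\<close>, now in the
      source; for \<open>i = 0\<close> it is \<open>x (- 1)\<close>, which is zero.\<close>
    have y2: "?y (i - 2) = (if i = 0 \<or> i = 1 then 0 else x (i - 1))"
      using True by auto
    have neg: "x (- 1) = 0"
      by (rule strip_systemD(2)[OF assms]) simp
    have "x (i + 1) = ?c + fps_X * (x (i + 2) + (if i = 0 then 0 else x i))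
        + fps_X ^ 2 * (x (i + 3) + (if i = 0 \<or> i = 1 then 0 else x (i - 1)))"
      unfolding x using neg by (auto simp: distrib_left)
    then show ?thesis
      using True unfolding y y1 y2 by simp
  next
    case False
    then show ?thesis
      using strip_systemD(3)[OF assms, of "i + 1"] by auto
  qed
qed

section \<open>Adding a level at the bottom\<close>

text \<open>The digits give the starting height, then the end height, the reverse of the argument
  order.\<close>

abbreviation "gf00 w \<equiv> walks_between_gf w 0 0"
abbreviation "gf10 w \<equiv> walks_between_gf w 0 1"
abbreviation "gf01 w \<equiv> walks_between_gf w 1 0"
abbreviation "gf11 w \<equiv> walks_between_gf w 1 1"

text \<open>\<open>c\<close> is what remains of the source at \<open>j\<close> after the shift: 0
  for \<open>j = 0\<close>, 1 for \<open>j = 1\<close>.\<close>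

lemma walks_between_gf_Suc:
  assumes "0 \<le> i"
    and b: "\<And>i. 0 \<le> i \<Longrightarrow> of_bool (i + 1 = j) = (c :: int fps) * of_bool (i = 0)"
  shows "walks_between_gf (Suc w) j (i + 1) =
    (c + fps_X * walks_between_gf (Suc w) j 0) * walks_between_gf w 0 i
    + fps_X ^ 2 * walks_between_gf (Suc w) j 0 * walks_between_gf w 1 i"
proof -
  let ?x = "walks_between_gf (Suc w) j"
  have "strip_system (int w + 1) (\<lambda>i. of_bool (i = j)) ?x"
    using strip_system_walks_between_gf[of "Suc w" j] by (simp add: add.commute)
  moreover have "of_bool (i + 1 = j) + fps_X * ?x 0 * of_bool (i = 0)
        + fps_X ^ 2 * ?x 0 * of_bool (i = 1) =
      (c + fps_X * ?x 0) * of_bool (i = 0) + fps_X ^ 2 * ?x 0 * of_bool (i = 1)" if "0 \<le> i" for i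
    unfolding b[OF that] by (simp only: distrib_right)
  ultimately have "(if i < 0 then 0 else ?x (i + 1)) =
      (c + fps_X * ?x 0) * walks_between_gf w 0 i + fps_X ^ 2 * ?x 0 * walks_between_gf w 1 i"
    by (intro strip_system_superposition[OF strip_system_shift])
  then show ?thesis
    using assms(1) by simp
qed

lemma bottom_Suc:
  "walks_between_gf (Suc w) j 0 = of_bool (j = 0)
    + fps_X * walks_between_gf (Suc w) j 1 + fps_X ^ 2 * walks_between_gf (Suc w) j 2"
  using strip_systemD[OF strip_system_walks_between_gf[of "Suc w" j], of 0]
    strip_systemD(2)[OF strip_system_walks_between_gf[of "Suc w" j], of "-1"]
    strip_systemD(2)[OF strip_system_walks_between_gf[of "Suc w" j], of "-2"]
  by auto

lemma from_above_to_0_Suc: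
  assumes "0 \<le> i"
  shows "walks_between_gf (Suc w) 0 (i + 1) =
    gf00 (Suc w) * (fps_X * walks_between_gf w 0 i + fps_X ^ 2 * walks_between_gf w 1 i)"
  using walks_between_gf_Suc[of i 0 0 w] assms by (simp add: algebra_simps)

lemma from_above_to_1_Suc:
  assumes "0 \<le> i"
  shows "walks_between_gf (Suc w) 1 (i + 1) = walks_between_gf w 0 i
    + gf01 (Suc w) * (fps_X * walks_between_gf w 0 i + fps_X ^ 2 * walks_between_gf w 1 i)"
  using walks_between_gf_Suc[of i 1 1 w] assms by (simp add: algebra_simps)

lemma gf10_Suc_gf01: "gf10 (Suc w) = gf00 (Suc w) * (fps_X * gf00 w + fps_X ^ 2 * gf01 w)"
  using from_above_to_0_Suc[of 0 w] by simp

lemma gf11_Suc_gf01: "gf11 (Suc w) = gf00 w + gf01 (Suc w) * (fps_X * gf00 w + fps_X ^ 2 * gf01 w)"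
  using from_above_to_1_Suc[of 0 w] by simp

text \<open>Decomposition at the first return to level 0. The bracket counts excursions: up by 1 or
  2, a walk in the strip of width \<open>w\<close> above the bottom, down by 1 or 2.\<close>

lemma gf00_Suc_gf01:
  "gf00 (Suc w) = 1 + gf00 (Suc w) * (fps_X ^ 2 * gf00 w + fps_X ^ 3 * gf01 w
      + fps_X ^ 3 * gf10 w + fps_X ^ 4 * gf11 w)"
proof -
  let ?x = "walks_between_gf (Suc w) 0"
  have "?x 0 = 1 + fps_X * ?x 1 + fps_X ^ 2 * ?x 2"
    "?x 1 = ?x 0 * (fps_X * gf00 w + fps_X ^ 2 * gf01 w)"
    "?x 2 = ?x 0 * (fps_X * gf10 w + fps_X ^ 2 * gf11 w)"
    using bottom_Suc[of w 0] from_above_to_0_Suc[of 0 w] from_above_to_0_Suc[of 1 w] by auto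
  then show ?thesis by algebra
qed

lemma gf01_Suc:
  "gf01 (Suc w) = fps_X * gf00 w + fps_X ^ 2 * gf10 w + gf01 (Suc w) *
     (fps_X ^ 2 * gf00 w + fps_X ^ 3 * gf01 w + fps_X ^ 3 * gf10 w + fps_X ^ 4 * gf11 w)"
proof -
  let ?x = "walks_between_gf (Suc w) 1"
  have "?x 0 = fps_X * ?x 1 + fps_X ^ 2 * ?x 2"
    "?x 1 = gf00 w + ?x 0 * (fps_X * gf00 w + fps_X ^ 2 * gf01 w)"
    "?x 2 = gf10 w + ?x 0 * (fps_X * gf10 w + fps_X ^ 2 * gf11 w)"
    using bottom_Suc[of w 1] from_above_to_1_Suc[of 0 w] from_above_to_1_Suc[of 1 w] by auto
  then show ?thesis by algebra
qed

lemma gf01_eq_gf10: "gf01 w = gf10 w"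
proof (induction w)
  case 0
  have "gf01 0 = 0" "gf10 0 = 0"
    using strip_systemD(3)[OF strip_system_walks_between_gf[of 0 0], of 1]
      strip_systemD[OF strip_system_walks_between_gf[of 0 1]]
    by simp_all
  then show ?case by simp
next
  case (Suc w)
  show ?case
    \<comment> \<open>With the excursion series \<open>E\<close>, \<open>gf00_Suc_gf01\<close> makes
      \<open>gf00 (Suc w)\<close> the inverse of \<open>1 - E\<close>; solving
      \<open>gf01_Suc\<close> with it gives the formula for \<open>gf10 (Suc w)\<close>, up to the
      induction hypothesis.\<close>
    using gf10_Suc_gf01[of w] gf00_Suc_gf01[of w] gf01_Suc[of w] Suc by algebra
qed

lemmas gf10_Suc = gf10_Suc_gf01[unfolded gf01_eq_gf10]
lemmas gf11_Suc = gf11_Suc_gf01[unfolded gf01_eq_gf10]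

lemma gf00_Suc:
  "gf00 (Suc w) = 1 + gf00 (Suc w) *
     (fps_X ^ 2 * gf00 w + 2 * fps_X ^ 3 * gf10 w + fps_X ^ 4 * gf11 w)"
  using gf00_Suc_gf01[of w] unfolding gf01_eq_gf10 by (simp add: algebra_simps)

text \<open>Multiply \<open>gf11_Suc\<close> by \<open>gf00 (Suc w)\<close>: the last summand
  becomes the square of \<open>gf10 (Suc w)\<close>. This is Jacobi's identity for a 2 by 2 minor of
  the inverse of the system matrix.\<close>

lemma jacobi: "gf11 (Suc w) * gf00 (Suc w) - gf10 (Suc w) ^ 2 = gf00 (Suc w) * gf00 w"
  using gf10_Suc[of w] gf11_Suc[of w] by algebra

text \<open>With \<open>f\<close>, \<open>p\<close>, \<open>q\<close> of width \<open>Suc w\<close>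
  and \<open>g = gf00 (Suc (Suc w))\<close>, the left side is
  \<open>f + g * (fps_X * f + fps_X ^ 2 * p) ^ 2\<close>. Multiplying \<open>gf00_Suc\<close> by
  \<open>f\<close> and replacing \<open>q * f\<close> by \<open>jacobi\<close> produces the same
  square, which cancels.\<close>

lemma gf11_Suc_Suc:
  "gf11 (Suc (Suc w)) = gf00 (Suc (Suc w)) * gf00 (Suc w) * (1 - fps_X ^ 4 * gf00 w)"
  using gf10_Suc[of "Suc w"] gf11_Suc[of "Suc w"] gf00_Suc[of "Suc w"] jacobi[of w] by algebra

lemma gf00_add_3:
  "gf00 (w + 3) = 1 + gf00 (w + 3) * (fps_X ^ 2 * gf00 (w + 2) + 2 * fps_X ^ 3 * gf10 (w + 2)
      + fps_X ^ 4 * (gf00 (w + 2) * gf00 (w + 1) * (1 - fps_X ^ 4 * gf00 w)))"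
proof -
  have "w + 3 = Suc (Suc (Suc w))" "w + 2 = Suc (Suc w)" "w + 1 = Suc w"
    by auto
  then show ?thesis
    using gf00_Suc[of "Suc (Suc w)"] unfolding gf11_Suc_Suc by (simp only:)
qed

lemma gf00_recurrence:
  "gf00 (w + 4) = 1 - fps_X ^ 2 * gf00 (w + 4) + 2 * fps_X ^ 2 * gf00 (w + 4) * gf00 (w + 3)
    + 2 * fps_X ^ 4 * gf00 (w + 4) * gf00 (w + 3) * gf00 (w + 2)
    - (fps_X ^ 6 + fps_X ^ 8) * gf00 (w + 4) * gf00 (w + 3) * gf00 (w + 2) * gf00 (w + 1)
    + fps_X ^ 10 * gf00 (w + 4) * gf00 (w + 3) * gf00 (w + 2) * gf00 (w + 1) * gf00 w"
proof -
  have w: "w + 1 + 3 = w + 4" "w + 1 + 2 = w + 3" "w + 1 + 1 = w + 2" "Suc (w + 2) = w + 3"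
    by auto
  have "gf00 (w + 4) = 1 + gf00 (w + 4) * (fps_X ^ 2 * gf00 (w + 3) + 2 * fps_X ^ 3 * gf10 (w + 3)
      + fps_X ^ 4 * (gf00 (w + 3) * gf00 (w + 2) * (1 - fps_X ^ 4 * gf00 (w + 1))))"
    using gf00_add_3[of "w + 1"] by (simp only: w)
  moreover have "gf10 (w + 3) = gf00 (w + 3) * (fps_X * gf00 (w + 2) + fps_X ^ 2 * gf10 (w + 2))"
    using gf10_Suc[of "w + 2"] by (simp only: w)
  ultimately show ?thesis
    \<comment> \<open>The remaining term \<open>2 * fps_X ^ 5 * gf00 (w + 3) * gf10 (w + 2)\<close>
      is \<open>fps_X ^ 2\<close> times one in \<open>gf00_add_3\<close>, so \<open>gf10\<close> is
      eliminated without division.\<close>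
    using gf00_add_3[of w] by algebra
qed

section \<open>Back to the variable \<open>z\<close>\<close>

lemma walks_between_0_0: "walks_between w 0 0 n = {p \<in> strip_walks w. sum_list p = (n, 0)}"
  by (auto simp: walks_between_def strip_walks_def)

lemma gf00_eq_compose: "gf00 w = walk_gf w oo fps_X ^ 2"
proof (rule fps_ext)
  fix n
  have "card {p \<in> strip_walks w. sum_list p = (int n, 0)} = 0" if "odd n"
  proof -
    have "{p \<in> strip_walks w. sum_list p = (int n, 0)} = {}"
      using even_fst_if_ends_on_axis that by fastforce
    then show ?thesis by (simp only: card.empty)
  qed
  then show "fps_nth (gf00 w) n = fps_nth (walk_gf w oo fps_X ^ 2) n"
    by (auto simp: fps_nth_compose_X_power walks_between_gf_def walk_gf_def num_walks_def
        walks_between_0_0)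
qed

theorem theorem1:
  fixes w :: nat
  assumes "w \<ge> 4"
  shows "walk_gf w =
      1 - fps_X * walk_gf w
        + 2 * fps_X * walk_gf w * walk_gf (w - 1)
        + 2 * fps_X ^ 2 * walk_gf w * walk_gf (w - 1) * walk_gf (w - 2)
        - (fps_X ^ 3 + fps_X ^ 4) * walk_gf w * walk_gf (w - 1) * walk_gf (w - 2) * walk_gf (w - 3)
        + fps_X ^ 5 * walk_gf w * walk_gf (w - 1) * walk_gf (w - 2) * walk_gf (w - 3) * walk_gf (w - 4)"
    (is "_ = ?rhs")
proof -
  let ?z = "fps_X ^ 2 :: int fps"
  obtain v where v: "w = v + 4"
    using assms by (metis add.commute le_Suc_ex)
  have w: "w - 1 = v + 3" "w - 2 = v + 2" "w - 3 = v + 1" "w - 4 = v"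
    using v by auto
  have z0: "fps_nth ?z 0 = 0"
    by simp
  note compose = fps_compose_sub_distrib fps_compose_add_distrib fps_compose_mult_distrib[OF z0]
    fps_compose_power[OF z0, symmetric]
  have "?rhs oo ?z = gf00 w"
  proof -
    have "?rhs oo ?z = 1 - fps_X ^ 2 * gf00 (v + 4) + 2 * fps_X ^ 2 * gf00 (v + 4) * gf00 (v + 3)
      + 2 * fps_X ^ 4 * gf00 (v + 4) * gf00 (v + 3) * gf00 (v + 2)
      - (fps_X ^ 6 + fps_X ^ 8) * gf00 (v + 4) * gf00 (v + 3) * gf00 (v + 2) * gf00 (v + 1)
      + fps_X ^ 10 * gf00 (v + 4) * gf00 (v + 3) * gf00 (v + 2) * gf00 (v + 1) * gf00 v"
      unfolding w unfolding v by (simp add: compose gf00_eq_compose power_mult[symmetric])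
    then show ?thesis
      unfolding v gf00_recurrence[of v, symmetric] .
  qed
  then have "(?rhs - walk_gf w) oo ?z = 0"
    by (simp only: fps_compose_sub_distrib gf00_eq_compose) simp
  \<comment> \<open>Substituting a nonzero series without constant term is injective.\<close>
  then have "?rhs - walk_gf w = 0"
    unfolding fps_compose_eq_0_iff[OF z0] by auto
  then show ?thesis
    by (simp only: right_minus_eq)
qed

end
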